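(* Let $\mathbf{K}\in\mathbb{R}^{p\times d}$ be nonzero, $b\in\mathrm{range}(\mathbf{K})$, $F:\mathbb{R}^d\to\mathbb{R}$ be $L$-smooth and $\mu$-strongly convex with $\kappa=L/\mu$, $\mathbf{W}=\mathbf{K}^T\mathbf{K}$, and let $(x^\star,y^\star)$ be the optimal primal–dual pair described in the context. Consider $\lambda_1 \geq \lambda_{\max}(\mathbf{W})$ and $\lambda_2$ such that $0 < \lambda_2 \leq \lambda_{\min}^+(\mathbf{W})$, and denote $\chi \coloneqq \lambda_1/\lambda_2$. Set $\tau \coloneqq \min \left\{1,\frac{1}{2}\sqrt{\frac{\chi}{\kappa} }\right\}$, $\eta \coloneqq \frac{1} {4\tau L}$, $\theta \coloneqq \frac{1}{\eta\lambda_1}$, and $\alpha \coloneqq \mu$, and run Algorithm B (described in the context). Then for all $k\ge0$, $$\frac{1}{\eta}\|x^k - x^{\star}\|^2 + \frac{\eta\alpha}{\theta(1+\eta\alpha)}\|y^k - y^{\star}\|^2 + \frac{2(1-\tau)}{\tau}\mathrm{D}_F(x_f^k, x^{\star}) \leq \left(1 + \frac{1}{4}\min\left\{\frac{1}{\sqrt{\kappa\chi}},\frac{1}{\chi}\right\}\right)^{-k} C,$$ where $C \coloneqq \frac{1}{\eta}\|x^0 - x^{\star}\|^2 + \frac{1}{\theta}\|y^0 - y^{\star}\|^2 + \frac{2(1-\tau)}{\tau}\mathrm{D}_F(x_f^0, x^{\star})$.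
   Context: $F$ is $L$-smooth ($\nabla F$ is $L$-Lipschitz) and $\mu$-strongly convex ($F-\frac{\mu}{2}\|\cdot\|^2$ convex), $0<\mu\le L$. $\mathrm{D}_F(x,x') \coloneqq F(x) - F(x') -\langle\nabla F(x'),x-x'\rangle$. $\lambda_{\max}(\mathbf{W})$ and $\lambda_{\min}^+(\mathbf{W})$ are the largest and smallest positive eigenvalues of $\mathbf{W}$. $x^\star$ is the unique minimizer of $F$ on $\{x:\mathbf{K}x=b\}$, and $y^\star$ is the unique vector in $\mathrm{range}(\mathbf{K})$ with $\nabla F(x^\star)+\mathbf{K}^Ty^\star=0$. Algorithm B (parameters $x^0\in\mathbb{R}^d$, $y^0=0\in\mathbb{R}^p$, $\eta,\theta,\alpha>0$, $\tau$): set $x_f^0=x^0$. For $k=0,1,\ldots$: $x_g^k = \tau x^k + (1-\tau)x_f^k$; $x^{k+\frac12} = (1+\eta\alpha)^{-1}\big(x^k - \eta(\nabla F(x_g^k) - \alpha x_g^k + \mathbf{K}^T y^k)\big)$; $y^{k+1} = y^k + \theta(\mathbf{K}x^{k+\frac12} - b)$; $x^{k+1} = (1+\eta\alpha)^{-1}\big(x^k - \eta(\nabla F(x_g^k) - \alpha x_g^k + \mathbf{K}^T y^{k+1})\big)$; $x_f^{k+1} = x_g^k + \frac{2\tau}{2-\tau}(x^{k+1}-x^k)$. *)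

theory Defs
  imports "HOL-Analysis.Analysis"
begin

text \<open>Bregman divergence of F (with gradient gradF).\<close>
definition bregman :: "(real^'d \<Rightarrow> real) \<Rightarrow> (real^'d \<Rightarrow> real^'d) \<Rightarrow> real^'d \<Rightarrow> real^'d \<Rightarrow> real" where
  "bregman F gradF x x' = F x - F x' - gradF x' \<bullet> (x - x')"

text \<open>Eigenvalues of a real square matrix.\<close>
definition eigenvalues :: "real^'n^'n \<Rightarrow> real set" where
  "eigenvalues W = {l. \<exists>v. v \<noteq> 0 \<and> W *v v = l *\<^sub>R v}"

text \<open>One iteration of Algorithm B; state is (x^k, y^k, x_f^k).\<close>
definition algB_step ::
  "(real^'d \<Rightarrow> real^'d) \<Rightarrow> real^'d^'p \<Rightarrow> real^'p \<Rightarrow> real \<Rightarrow> real \<Rightarrow> real \<Rightarrow> real \<Rightarrow>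
   ((real^'d) \<times> (real^'p) \<times> (real^'d)) \<Rightarrow> ((real^'d) \<times> (real^'p) \<times> (real^'d))" where
  "algB_step gradF K b eta theta alpha tau s =
     (case s of (x, y, xf) \<Rightarrow>
       let xg = tau *\<^sub>R x + (1 - tau) *\<^sub>R xf;
           xh = inverse (1 + eta * alpha) *\<^sub>R (x - eta *\<^sub>R (gradF xg - alpha *\<^sub>R xg + transpose K *v y));
           y' = y + theta *\<^sub>R (K *v xh - b);
           x' = inverse (1 + eta * alpha) *\<^sub>R (x - eta *\<^sub>R (gradF xg - alpha *\<^sub>R xg + transpose K *v y'));
           xf' = xg + (2 * tau / (2 - tau)) *\<^sub>R (x' - x)
       in (x', y', xf'))"

text \<open>The k-th iterate of Algorithm B started at x^0 with y^0 = 0, x_f^0 = x^0.\<close>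
definition algB ::
  "(real^'d \<Rightarrow> real^'d) \<Rightarrow> real^'d^'p \<Rightarrow> real^'p \<Rightarrow> real \<Rightarrow> real \<Rightarrow> real \<Rightarrow> real \<Rightarrow>
   real^'d \<Rightarrow> nat \<Rightarrow> ((real^'d) \<times> (real^'p) \<times> (real^'d))" where
  "algB gradF K b eta theta alpha tau x0 k = (algB_step gradF K b eta theta alpha tau ^^ k) (x0, 0, x0)"

end

theory Submission
  imports Defs
begin

(* A Lyapunov argument. With D the Bregman divergence of F at xs, the function
     lyapunov (x, y, x_f) = ||x - xs||^2 / eta + dual_energy (y - ys) + 2 (1 - tau) / tau * D x_f,
     dual_energy w = ||w||^2 / theta - eta / (1 + eta alpha) * ||K^T w||^2,
   decreases by the factor rho = 1 + min (1 / sqrt (kappa chi)) (1 / chi) / 4 in every step.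
   Expanding squares in the two x-updates and in the dual update bounds its new value by the old one up
   to the coupling term -2 <grad F x_g - grad F xs, x' - xs>; convexity and smoothness at x_g, strong
   convexity and cocoercivity of grad F turn this term into the descent of the Bregman term along x_f
   and leave a slack N >= 0. By optimality of (xs, ys), K^T (y' - ys) is a combination of the three
   quantities making up N, and y' - ys stays in range K, where ||K^T w||^2 >= lam2 ||w||^2; hence
   dual_energy (y' - ys) <= chi (2 + eta alpha + 1 / (2 tau)) N, and the choice of tau, eta, theta lets
   N pay for the factor rho. Finally ||K^T w||^2 <= lam1 ||w||^2 makes the Lyapunov function dominate
   the left-hand side. *)

lemma inner_extrapolation_split:
  fixes G x xf xg xs x' xf' :: "'a::real_inner"
  assumes tau: "0 < tau" "tau \<le> 1"
    and xg: "xg = tau *\<^sub>R x + (1 - tau) *\<^sub>R xf"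
    and xf': "xf' = xg + (2 * tau / (2 - tau)) *\<^sub>R (x' - x)"
  shows "G \<bullet> (x' - xs) = G \<bullet> (xg - xs) - (1 - tau) / tau * (G \<bullet> (xf - xg)) + (2 - tau) / (2 * tau) * (G \<bullet> (xf' - xg))"
proof -
  have "x - xs = (xg - xs) - ((1 - tau) / tau) *\<^sub>R (xf - xg)"
  proof -
    have "xf - xg = tau *\<^sub>R (xf - x)"
      unfolding xg by (simp add: algebra_simps)
    then have "((1 - tau) / tau) *\<^sub>R (xf - xg) = (1 - tau) *\<^sub>R (xf - x)"
      using tau by simp
    then show ?thesis
      unfolding xg by (simp add: algebra_simps)
  qed
  moreover have "x' - x = ((2 - tau) / (2 * tau)) *\<^sub>R (xf' - xg)"
    using tau unfolding xf' by simp
  moreover have "G \<bullet> (x' - xs) = G \<bullet> (x - xs) + G \<bullet> (x' - x)"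
    by (simp add: inner_diff_right)
  ultimately show ?thesis
    by (simp add: inner_diff_right)
qed

locale smooth_strongly_convex =
  fixes F :: "'a::real_inner \<Rightarrow> real" and gF :: "'a \<Rightarrow> 'a" and \<mu> L :: real
  assumes has_gradient: "\<And>x. (F has_derivative (\<lambda>h. gF x \<bullet> h)) (at x)"
    and gradient_lipschitz: "\<And>x y. norm (gF x - gF y) \<le> L * norm (x - y)"
    and strongly_convex: "convex_on UNIV (\<lambda>x. F x - \<mu> / 2 * norm x ^ 2)"
    and mu_pos: "0 < \<mu>" and mu_le_L: "\<mu> \<le> L"
begin

lemma L_pos: "0 < L"
  using mu_pos mu_le_L by simp

lemma has_real_derivative_along_line:
  "((\<lambda>t. F (x + t *\<^sub>R d)) has_real_derivative (gF (x + t *\<^sub>R d) \<bullet> d)) (at t)"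
proof -
  have line: "((\<lambda>t. x + t *\<^sub>R d) has_derivative (\<lambda>s. s *\<^sub>R d)) (at t)"
    by (auto intro!: derivative_eq_intros)
  have "((\<lambda>t. F (x + t *\<^sub>R d)) has_derivative (\<lambda>s. gF (x + t *\<^sub>R d) \<bullet> (s *\<^sub>R d))) (at t)"
    using has_derivative_compose[OF line has_gradient] by (simp add: o_def)
  then show ?thesis unfolding has_field_derivative_def
    by (rule has_derivative_eq_rhs) (auto simp: fun_eq_iff mult.commute)
qed

lemma strong_convexity_lower_bound:
  "F x + gF x \<bullet> (y - x) + \<mu> / 2 * norm (y - x) ^ 2 \<le> F y"
proof -
  define d where "d = y - x"
  define \<phi> where "\<phi> t = F (x + t *\<^sub>R d) - \<mu> / 2 * norm x ^ 2 - \<mu> * (x \<bullet> d) * t - \<mu> / 2 * norm d ^ 2 * t^2"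
    for t
  have \<phi>_eq: "\<phi> t = F (x + t *\<^sub>R d) - \<mu> / 2 * norm (x + t *\<^sub>R d) ^ 2" for t
    unfolding \<phi>_def
    by (simp only: power2_norm_eq_inner) (simp add: inner_simps algebra_simps power2_eq_square inner_commute)
  have "convex_on UNIV \<phi>"
  proof (rule convex_onI)
    fix t a b :: real assume t: "0 < t" "t < 1"
    have "x + ((1 - t) *\<^sub>R a + t *\<^sub>R b) *\<^sub>R d = (1 - t) *\<^sub>R (x + a *\<^sub>R d) + t *\<^sub>R (x + b *\<^sub>R d)"
      by (simp add: algebra_simps)
    then show "\<phi> ((1 - t) *\<^sub>R a + t *\<^sub>R b) \<le> (1 - t) * \<phi> a + t * \<phi> b"
      unfolding \<phi>_eq using convex_onD[OF strongly_convex, of t "x + a *\<^sub>R d" "x + b *\<^sub>R d"] t by simp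
  qed simp
  moreover have "(\<phi> has_real_derivative (gF x \<bullet> d - \<mu> * (x \<bullet> d))) (at 0)"
  proof -
    have "(\<phi> has_real_derivative
        (gF (x + 0 *\<^sub>R d) \<bullet> d - 0 - \<mu> * (x \<bullet> d) * 1 - \<mu> / 2 * norm d ^ 2 * (2 * 0))) (at 0)"
      unfolding \<phi>_def using DERIV_pow[of 2 0]
      by (intro DERIV_diff DERIV_const DERIV_cmult DERIV_ident has_real_derivative_along_line) simp
    then show ?thesis by simp
  qed
  ultimately have "(gF x \<bullet> d - \<mu> * (x \<bullet> d)) * (1 - 0) \<le> \<phi> 1 - \<phi> 0"
    by (intro convex_on_imp_above_tangent) (auto intro: has_field_derivative_at_within)
  then show ?thesis unfolding \<phi>_def d_def
    by (simp only: power2_norm_eq_inner) (simp add: inner_simps algebra_simps power2_eq_square inner_commute)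
qed

lemma convexity_lower_bound: "F x + gF x \<bullet> (y - x) \<le> F y"
proof -
  have "0 \<le> \<mu> / 2 * norm (y - x) ^ 2"
    using mu_pos by simp
  then show ?thesis
    using strong_convexity_lower_bound[of x y] by linarith
qed

lemma smoothness_upper_bound: "F y \<le> F x + gF x \<bullet> (y - x) + L / 2 * norm (y - x) ^ 2"
proof -
  define d where "d = y - x"
  define h where "h t = F (x + t *\<^sub>R d) - (gF x \<bullet> d) * t - L / 2 * norm d ^ 2 * t^2" for t
  have h_deriv: "(h has_real_derivative (gF (x + t *\<^sub>R d) \<bullet> d - gF x \<bullet> d - L * t * norm d ^ 2)) (at t)"
    for t
  proof -
    have "(h has_real_derivative
        (gF (x + t *\<^sub>R d) \<bullet> d - (gF x \<bullet> d) * 1 - L / 2 * norm d ^ 2 * (2 * t))) (at t)"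
      unfolding h_def using DERIV_pow[of 2 t]
      by (intro DERIV_diff DERIV_cmult DERIV_ident has_real_derivative_along_line) simp
    then show ?thesis by (rule DERIV_cong) (simp add: algebra_simps)
  qed
  have h_deriv_nonpos: "gF (x + t *\<^sub>R d) \<bullet> d - gF x \<bullet> d - L * t * norm d ^ 2 \<le> 0" if "0 \<le> t" for t
  proof -
    have "gF (x + t *\<^sub>R d) \<bullet> d - gF x \<bullet> d = (gF (x + t *\<^sub>R d) - gF x) \<bullet> d"
      by (simp add: inner_simps)
    also have "\<dots> \<le> norm (gF (x + t *\<^sub>R d) - gF x) * norm d"
      by (rule norm_cauchy_schwarz)
    also have "\<dots> \<le> L * norm (t *\<^sub>R d) * norm d"
      using gradient_lipschitz[of "x + t *\<^sub>R d" x] by (simp add: mult_right_mono)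
    also have "\<dots> = L * t * norm d ^ 2"
      using that by (simp add: power2_eq_square)
    finally show ?thesis by simp
  qed
  have "h 1 \<le> h 0"
  proof (rule DERIV_nonpos_imp_nonincreasing[of 0 1 h])
    fix t :: real assume "0 \<le> t"
    then show "\<exists>D. (h has_real_derivative D) (at t) \<and> D \<le> 0"
      using h_deriv h_deriv_nonpos by blast
  qed simp
  then show ?thesis unfolding h_def d_def by simp
qed

lemma bregman_ge_gradient_difference:
  "norm (gF y - gF x) ^ 2 / (2 * L) \<le> F y - F x - gF x \<bullet> (y - x)"
proof -
  define g where "g = gF y - gF x"
  define w where "w = y - (1 / L) *\<^sub>R g"
  have "F x + gF x \<bullet> (w - x) \<le> F w"
    by (rule convexity_lower_bound)
  moreover have "F w \<le> F y + gF y \<bullet> (w - y) + L / 2 * norm (w - y) ^ 2"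
    by (rule smoothness_upper_bound)
  moreover have "gF y \<bullet> (w - y) - gF x \<bullet> (w - y) = - (1 / L) * norm g ^ 2"
    unfolding w_def g_def by (simp add: inner_simps power2_norm_eq_inner algebra_simps)
  moreover have "L / 2 * norm (w - y) ^ 2 = norm g ^ 2 / (2 * L)"
    unfolding w_def using L_pos by (simp add: power2_eq_square field_simps)
  moreover have "- (1 / L) * norm g ^ 2 + norm g ^ 2 / (2 * L) = - (norm g ^ 2 / (2 * L))"
    using L_pos by (simp add: field_simps)
  moreover have "gF x \<bullet> (w - x) = gF x \<bullet> (y - x) + gF x \<bullet> (w - y)"
    by (simp add: inner_diff_right)
  ultimately show ?thesis
    unfolding g_def by linarith
qed

lemma gradient_inner_lower_bound:
  "F z - F xs - gF xs \<bullet> (z - xs) + \<mu> * norm (z - xs) ^ 2 + norm (gF z - gF xs) ^ 2 / (2 * L)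
    \<le> 2 * ((gF z - gF xs) \<bullet> (z - xs))"
proof -
  have "\<mu> / 2 * norm (z - xs) ^ 2 \<le> F xs - F z - gF z \<bullet> (xs - z)"
    using strong_convexity_lower_bound[of z xs] by (simp add: norm_minus_commute)
  moreover have "\<mu> / 2 * norm (z - xs) ^ 2 \<le> F z - F xs - gF xs \<bullet> (z - xs)"
    using strong_convexity_lower_bound[of xs z] by simp
  moreover have "norm (gF z - gF xs) ^ 2 / (2 * L) \<le> F xs - F z - gF z \<bullet> (xs - z)"
    using bregman_ge_gradient_difference[of xs z] by (simp add: norm_minus_commute)
  moreover have "(gF z - gF xs) \<bullet> (z - xs) = (F z - F xs - gF xs \<bullet> (z - xs)) + (F xs - F z - gF z \<bullet> (xs - z))"
    by (simp add: inner_diff_left inner_diff_right inner_commute)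
  ultimately show ?thesis
    by linarith
qed

lemma gradient_coupling_bound:
  fixes x xf xg xs x' xf' :: 'a and tau eta :: real
  assumes tau: "0 < tau" "tau \<le> 1" and eta: "eta = 1 / (4 * tau * L)"
    and xg_def: "xg = tau *\<^sub>R x + (1 - tau) *\<^sub>R xf"
    and xf'_def: "xf' = xg + (2 * tau / (2 - tau)) *\<^sub>R (x' - x)"
  defines "D \<equiv> \<lambda>z. F z - F xs - gF xs \<bullet> (z - xs)"
  shows "- 2 * ((gF xg - gF xs) \<bullet> (x' - xs))
    \<le> 2 * (1 - tau) / tau * D xf - (2 - tau) / tau * D xf' + 1 / (2 * eta) * norm (x' - x) ^ 2
       - \<mu> * norm (xg - xs) ^ 2 - norm (gF xg - gF xs) ^ 2 / (2 * L)"
proof -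
  define G where "G = gF xg - gF xs"
  define T where "T = 2 * (1 - tau) / tau"
  have "0 \<le> T" and T_plus_1: "(2 - tau) / tau = T + 1"
    using tau unfolding T_def by (auto simp: field_simps)
  have D_diff: "D z - D w = F z - F w - gF xs \<bullet> (z - w)" for z w
    unfolding D_def by (simp add: inner_simps)
  have "- 2 * (G \<bullet> (x' - xs)) = - 2 * (G \<bullet> (xg - xs)) + T * (G \<bullet> (xf - xg)) - (T + 1) * (G \<bullet> (xf' - xg))"
    using inner_extrapolation_split[OF tau xg_def xf'_def, of G xs] tau unfolding T_def by (simp add: field_simps)
  moreover have "T * (G \<bullet> (xf - xg)) \<le> T * D xf - T * D xg"
  proof -
    have "G \<bullet> (xf - xg) \<le> D xf - D xg"
      using convexity_lower_bound[of xg xf] unfolding D_diff G_def by (simp add: inner_diff_left)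
    from mult_left_mono[OF this \<open>0 \<le> T\<close>] show ?thesis
      by (simp add: right_diff_distrib)
  qed
  moreover have "- ((T + 1) * (G \<bullet> (xf' - xg)))
      \<le> (T + 1) * (L / 2 * norm (xf' - xg) ^ 2) - (T + 1) * D xf' + (T + 1) * D xg"
  proof -
    have "D xf' - D xg - G \<bullet> (xf' - xg) \<le> L / 2 * norm (xf' - xg) ^ 2"
      using smoothness_upper_bound[of xf' xg] unfolding D_diff G_def by (simp add: inner_diff_left)
    from mult_left_mono[OF this, of "T + 1"] \<open>0 \<le> T\<close> show ?thesis
      by (simp add: right_diff_distrib)
  qed
  moreover have "(T + 1) * (L / 2 * norm (xf' - xg) ^ 2) \<le> 1 / (2 * eta) * norm (x' - x) ^ 2"
  proof -
    define s where "s = 2 * tau / (2 - tau)"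
    have "(T + 1) * s = 2"
      using tau unfolding T_def s_def by (simp add: field_simps)
    have "norm (xf' - xg) ^ 2 = s ^ 2 * norm (x' - x) ^ 2"
      unfolding xf'_def s_def using tau by (simp add: power_mult_distrib power_divide)
    then have "(T + 1) * (L / 2 * norm (xf' - xg) ^ 2) = L / 2 * ((T + 1) * s) * s * norm (x' - x) ^ 2"
      by (simp add: power2_eq_square algebra_simps)
    also have "\<dots> = L * s * norm (x' - x) ^ 2"
      unfolding \<open>(T + 1) * s = 2\<close> by simp
    also have "\<dots> \<le> L * (2 * tau) * norm (x' - x) ^ 2"
      using tau L_pos unfolding s_def by (intro mult_right_mono mult_left_mono) (auto simp: field_simps)
    also have "\<dots> = 1 / (2 * eta) * norm (x' - x) ^ 2"
      using tau L_pos unfolding eta by simp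
    finally show ?thesis .
  qed
  moreover have "- 2 * (G \<bullet> (xg - xs)) + D xg \<le> - \<mu> * norm (xg - xs) ^ 2 - norm G ^ 2 / (2 * L)"
    using gradient_inner_lower_bound[of xg xs] unfolding D_def G_def by linarith
  moreover have "(2 - tau) / tau * D xf' = T * D xf' + D xf'"
    "(T + 1) * D xf' = T * D xf' + D xf'" "(T + 1) * D xg = T * D xg + D xg"
    unfolding T_plus_1 by (simp_all add: distrib_right)
  ultimately show ?thesis
    unfolding G_def[symmetric] T_def[symmetric] by linarith
qed
end

lemma primal_distance_identity:
  fixes u u' ug G v :: "'a::real_inner"
  assumes step: "(1 / eta) *\<^sub>R (u' - u) + alpha *\<^sub>R (u' - ug) + G + v = 0"
  shows "1 / eta * norm u' ^ 2 = 1 / eta * norm u ^ 2 - 1 / eta * norm (u' - u) ^ 2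
    - alpha * norm u' ^ 2 - alpha * norm (u' - ug) ^ 2 + alpha * norm ug ^ 2 - 2 * (G \<bullet> u') - 2 * (v \<bullet> u')"
proof -
  have "(1 / eta) *\<^sub>R (u' - u) = - (alpha *\<^sub>R (u' - ug) + G + v)"
    using step by (metis add.assoc eq_neg_iff_add_eq_0)
  then have "((1 / eta) *\<^sub>R (u' - u)) \<bullet> u' = - alpha * ((u' - ug) \<bullet> u') - G \<bullet> u' - v \<bullet> u'"
    by (simp add: inner_add_left inner_diff_left)
  then have "1 / eta * ((u' - u) \<bullet> u') = - alpha * ((u' - ug) \<bullet> u') - G \<bullet> u' - v \<bullet> u'"
    by simp
  moreover have "1 / eta * norm u' ^ 2 = 1 / eta * norm u ^ 2 + 2 * (1 / eta * ((u' - u) \<bullet> u')) - 1 / eta * norm (u' - u) ^ 2"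
  proof -
    have "norm u' ^ 2 = norm u ^ 2 + 2 * ((u' - u) \<bullet> u') - norm (u' - u) ^ 2"
      by (simp only: power2_norm_eq_inner) (simp add: inner_simps inner_commute)
    then have "1 / eta * norm u' ^ 2 = 1 / eta * (norm u ^ 2 + 2 * ((u' - u) \<bullet> u') - norm (u' - u) ^ 2)"
      by (rule arg_cong)
    then show ?thesis
      by (simp add: algebra_simps)
  qed
  moreover have "alpha * (2 * ((u' - ug) \<bullet> u')) = alpha * norm u' ^ 2 + alpha * norm (u' - ug) ^ 2 - alpha * norm ug ^ 2"
  proof -
    have "2 * ((u' - ug) \<bullet> u') = norm u' ^ 2 + norm (u' - ug) ^ 2 - norm ug ^ 2"
      by (simp only: power2_norm_eq_inner) (simp add: inner_simps inner_commute)
    then have "alpha * (2 * ((u' - ug) \<bullet> u')) = alpha * (norm u' ^ 2 + norm (u' - ug) ^ 2 - norm ug ^ 2)"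
      by (rule arg_cong)
    then show ?thesis
      by (simp add: algebra_simps)
  qed
  ultimately show ?thesis
    by linarith
qed

lemma dual_distance_estimate:
  fixes Kf :: "'a::real_inner \<Rightarrow> 'b::real_inner" and Kt :: "'b \<Rightarrow> 'a"
  assumes adjoint: "\<And>y x. Kt y \<bullet> x = y \<bullet> Kf x" and "linear Kt"
    and Kt_bound: "\<And>y. norm (Kt y) ^ 2 \<le> lam * norm y ^ 2"
    and "0 < theta" "0 \<le> gamma" "gamma * lam \<le> 1 / theta"
    and dual_step: "w' = w + theta *\<^sub>R Kf uh"
    and coupling: "uh - u' = gamma *\<^sub>R Kt (w' - w)"
  shows "1 / theta * norm w' ^ 2 - gamma * norm (Kt w') ^ 2
    \<le> 1 / theta * norm w ^ 2 - gamma * norm (Kt w) ^ 2 + 2 * (Kt w' \<bullet> u')"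
proof -
  have "norm w' ^ 2 = norm w ^ 2 + 2 * ((w' - w) \<bullet> w') - norm (w' - w) ^ 2"
    by (simp only: power2_norm_eq_inner) (simp add: inner_simps inner_commute)
  moreover have "(w' - w) \<bullet> w' = theta * (Kt w' \<bullet> uh)"
    unfolding dual_step adjoint by (simp add: inner_commute)
  ultimately have "1 / theta * norm w' ^ 2
      = 1 / theta * (norm w ^ 2 + theta * (2 * (Kt w' \<bullet> uh)) - norm (w' - w) ^ 2)"
    by simp
  also have "\<dots> = 1 / theta * norm w ^ 2 + 2 * (Kt w' \<bullet> uh) - 1 / theta * norm (w' - w) ^ 2"
    using \<open>0 < theta\<close> by (simp add: diff_divide_distrib add_divide_distrib)
  finally have "1 / theta * norm w' ^ 2 = 1 / theta * norm w ^ 2 + 2 * (Kt w' \<bullet> uh) - 1 / theta * norm (w' - w) ^ 2" .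
  moreover have "Kt w' \<bullet> uh = Kt w' \<bullet> u' + gamma * (Kt w' \<bullet> Kt (w' - w))"
    using coupling by (metis add_diff_cancel_left' diff_add_cancel inner_add_right inner_scaleR_right)
  moreover have "2 * (Kt w' \<bullet> Kt (w' - w)) = norm (Kt w') ^ 2 + norm (Kt (w' - w)) ^ 2 - norm (Kt w) ^ 2"
    using \<open>linear Kt\<close>
    by (simp only: power2_norm_eq_inner linear_diff) (simp add: inner_simps inner_commute)
  moreover have "gamma * norm (Kt (w' - w)) ^ 2 \<le> 1 / theta * norm (w' - w) ^ 2"
  proof -
    have "gamma * norm (Kt (w' - w)) ^ 2 \<le> gamma * (lam * norm (w' - w) ^ 2)"
      using Kt_bound \<open>0 \<le> gamma\<close> by (rule mult_left_mono)
    also have "\<dots> \<le> 1 / theta * norm (w' - w) ^ 2"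
      using mult_right_mono[OF \<open>gamma * lam \<le> 1 / theta\<close> zero_le_power2] by (simp only: mult.assoc)
    finally show ?thesis .
  qed
  ultimately show ?thesis
    by (simp add: algebra_simps)
qed

lemma norm_weighted_sum3_squared_le:
  fixes m1 m2 m3 :: "'a::real_inner"
  assumes "0 \<le> p1" "0 \<le> p2" "0 \<le> p3"
  shows "norm (p1 *\<^sub>R m1 + p2 *\<^sub>R m2 + p3 *\<^sub>R m3) ^ 2
    \<le> (p1 + p2 + p3) * (p1 * norm m1 ^ 2 + p2 * norm m2 ^ 2 + p3 * norm m3 ^ 2)"
proof -
  have "(p1 + p2 + p3) * (p1 * norm m1 ^ 2 + p2 * norm m2 ^ 2 + p3 * norm m3 ^ 2)
      - norm (p1 *\<^sub>R m1 + p2 *\<^sub>R m2 + p3 *\<^sub>R m3) ^ 2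
      = p1 * p2 * norm (m1 - m2) ^ 2 + p1 * p3 * norm (m1 - m3) ^ 2 + p2 * p3 * norm (m2 - m3) ^ 2"
    by (simp only: power2_norm_eq_inner) (simp add: inner_simps algebra_simps inner_commute power2_eq_square)
  moreover have "0 \<le> p1 * p2 * norm (m1 - m2) ^ 2 + p1 * p3 * norm (m1 - m3) ^ 2 + p2 * p3 * norm (m2 - m3) ^ 2"
    using assms by (intro add_nonneg_nonneg mult_nonneg_nonneg) auto
  ultimately show ?thesis
    by linarith
qed

lemma norm_dual_residual_le:
  fixes u u' ug G v :: "'a::real_inner"
  assumes "0 < eta" "0 < alpha" "0 < L"
    and step: "(1 / eta) *\<^sub>R (u' - u) + alpha *\<^sub>R (u' - ug) + G + v = 0"
  shows "norm v ^ 2 \<le> (2 / eta + alpha + 2 * L)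
    * (1 / (2 * eta) * norm (u' - u) ^ 2 + alpha * norm (u' - ug) ^ 2 + norm G ^ 2 / (2 * L))"
proof -
  have "v = - ((1 / eta) *\<^sub>R (u' - u) + alpha *\<^sub>R (u' - ug) + G)"
    using add_eq_0_iff step by blast
  also have "\<dots> = - ((2 / eta) *\<^sub>R ((1 / 2) *\<^sub>R (u' - u)) + alpha *\<^sub>R (u' - ug) + (2 * L) *\<^sub>R ((1 / (2 * L)) *\<^sub>R G))"
    using \<open>0 < L\<close> by simp
  finally have "norm v ^ 2 \<le> (2 / eta + alpha + 2 * L) * (2 / eta * norm ((1 / 2) *\<^sub>R (u' - u)) ^ 2
      + alpha * norm (u' - ug) ^ 2 + 2 * L * norm ((1 / (2 * L)) *\<^sub>R G) ^ 2)"
    using assms by (simp only: norm_minus_cancel) (intro norm_weighted_sum3_squared_le; simp)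
  also have "2 / eta * norm ((1 / 2) *\<^sub>R (u' - u)) ^ 2 + alpha * norm (u' - ug) ^ 2 + 2 * L * norm ((1 / (2 * L)) *\<^sub>R G) ^ 2
      = 1 / (2 * eta) * norm (u' - u) ^ 2 + alpha * norm (u' - ug) ^ 2 + norm G ^ 2 / (2 * L)"
  proof -
    have "2 / eta * norm ((1 / 2) *\<^sub>R (u' - u)) ^ 2 = 1 / (2 * eta) * norm (u' - u) ^ 2"
      by (simp only: norm_scaleR power_mult_distrib) (simp add: power2_eq_square)
    moreover have "2 * L * norm ((1 / (2 * L)) *\<^sub>R G) ^ 2 = norm G ^ 2 / (2 * L)"
      using \<open>0 < L\<close> by (simp only: norm_scaleR power_mult_distrib) (simp add: power2_eq_square)
    ultimately show ?thesis
      by simp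
  qed
  finally show ?thesis .
qed

(* Testing the lower bound at v - t w with w = A v - m v gives 2 t ||w||^2 <= O(t^2) for all t > 0. *)
lemma rayleigh_minimizer_is_eigenvector:
  fixes A :: "'a::real_inner \<Rightarrow> 'a"
  assumes "linear A" and self_adjoint: "\<And>z w. A z \<bullet> w = z \<bullet> A w"
    and S: "subspace S" "v \<in> S" "\<And>z. z \<in> S \<Longrightarrow> A z \<in> S"
    and lower: "\<And>z. z \<in> S \<Longrightarrow> m * norm z ^ 2 \<le> A z \<bullet> z"
    and attained: "A v \<bullet> v = m * norm v ^ 2"
  shows "A v = m *\<^sub>R v"
proof -
  define w where "w = A v - m *\<^sub>R v"
  have "w \<in> S"
    unfolding w_def using S by (intro subspace_diff subspace_scale) auto
  define c where "c = A w \<bullet> w - m * (w \<bullet> w)"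
  have first_variation: "2 * t * (w \<bullet> w) \<le> t^2 * c" if "t > 0" for t
  proof -
    have "v - t *\<^sub>R w \<in> S"
      using S \<open>w \<in> S\<close> by (intro subspace_diff subspace_scale) auto
    have A_diff: "A (v - t *\<^sub>R w) = A v - t *\<^sub>R A w"
      using \<open>linear A\<close> by (simp add: linear_diff linear_scale)
    have "m * norm (v - t *\<^sub>R w) ^ 2 \<le> A (v - t *\<^sub>R w) \<bullet> (v - t *\<^sub>R w)"
      by (rule lower) fact
    also have "\<dots> = A v \<bullet> v - 2 * t * (A v \<bullet> w) + t^2 * (A w \<bullet> w)"
      unfolding A_diff using self_adjoint[of w v]
      by (simp add: inner_simps power2_eq_square algebra_simps inner_commute)
    finally have "m * norm (v - t *\<^sub>R w) ^ 2 \<le> A v \<bullet> v - 2 * t * (A v \<bullet> w) + t^2 * (A w \<bullet> w)" .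
    moreover have "norm (v - t *\<^sub>R w) ^ 2 = v \<bullet> v - 2 * t * (v \<bullet> w) + t^2 * (w \<bullet> w)"
      by (simp only: power2_norm_eq_inner) (simp add: inner_simps power2_eq_square algebra_simps inner_commute)
    moreover have "A v \<bullet> w = w \<bullet> w + m * (v \<bullet> w)"
      unfolding w_def by (simp add: inner_simps algebra_simps)
    moreover have "A v \<bullet> v = m * (v \<bullet> v)"
      using attained by (simp add: power2_norm_eq_inner)
    ultimately show ?thesis
      unfolding c_def by (simp add: algebra_simps)
  qed
  have "w \<bullet> w = 0"
  proof (rule ccontr)
    assume "w \<bullet> w \<noteq> 0"
    then have pos: "w \<bullet> w > 0"
      by (simp add: order_less_le)
    define t where "t = (w \<bullet> w) / (\<bar>c\<bar> + 1)"
    have "t > 0"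
      unfolding t_def using pos by simp
    then have "2 * (w \<bullet> w) \<le> t * c"
      using first_variation[of t] by (simp add: power2_eq_square)
    moreover have "t * c \<le> t * \<bar>c\<bar>"
      using \<open>t > 0\<close> by (simp add: mult_left_mono)
    moreover have "t * \<bar>c\<bar> < w \<bullet> w"
      unfolding t_def using pos by (simp add: field_simps)
    ultimately show False
      using pos by linarith
  qed
  then show ?thesis
    unfolding w_def by simp
qed

lemma inner_transpose_matrix_vector: "(transpose K *v y) \<bullet> x = y \<bullet> ((K :: real^'n^'m) *v x)"
  by (simp add: dot_lmul_matrix)

lemma norm_linear_normalized:
  assumes "linear g" and "z \<noteq> 0"
  shows "norm (g ((1 / norm z) *\<^sub>R z)) = norm (g z) / norm z"
  using assms by (simp add: linear_scale divide_inverse mult.commute)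

lemma linear_attains_max_stretch:
  fixes g :: "'a::euclidean_space \<Rightarrow> 'b::real_normed_vector"
  assumes "linear g"
  obtains v where "norm v = 1" "\<And>z. norm (g z) \<le> norm (g v) * norm z"
proof -
  obtain u :: 'a where "norm u = 1"
    using vector_choose_size[of 1] by auto
  moreover have "continuous_on (sphere 0 1) (\<lambda>z. norm (g z))"
    using \<open>linear g\<close> by (intro continuous_intros linear_continuous_on linear_conv_bounded_linear[THEN iffD1])
  ultimately obtain v where v: "norm v = 1" and max: "\<And>z. norm z = 1 \<Longrightarrow> norm (g z) \<le> norm (g v)"
    using continuous_attains_sup[OF compact_sphere, of 0 1 "\<lambda>z. norm (g z)"] by auto
  have "norm (g z) \<le> norm (g v) * norm z" for z
  proof (cases "z = 0")
    case False
    then have "norm (g z) / norm z \<le> norm (g v)"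
      using max[of "(1 / norm z) *\<^sub>R z"] norm_linear_normalized[OF \<open>linear g\<close>] by simp
    then show ?thesis
      using False by (simp add: divide_le_eq)
  qed (use \<open>linear g\<close> in \<open>simp add: linear_0\<close>)
  with v that show ?thesis
    by blast
qed

lemma linear_attains_min_stretch_on_subspace:
  fixes g :: "'a::euclidean_space \<Rightarrow> 'b::real_normed_vector"
  assumes "linear g" and "subspace S" and "u \<in> S" "u \<noteq> 0"
  obtains v where "v \<in> S" "norm v = 1" "\<And>z. z \<in> S \<Longrightarrow> norm (g v) * norm z \<le> norm (g z)"
proof -
  have "(1 / norm u) *\<^sub>R u \<in> S \<inter> sphere 0 1"
    using assms by (simp add: subspace_scale)
  then have "S \<inter> sphere 0 1 \<noteq> {}"
    by blast
  moreover have "compact (S \<inter> sphere 0 1)"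
    using compact_Int_closed[OF compact_sphere closed_subspace[OF \<open>subspace S\<close>]] by (simp add: Int_commute)
  moreover have "continuous_on (S \<inter> sphere 0 1) (\<lambda>z. norm (g z))"
    using \<open>linear g\<close> by (intro continuous_intros linear_continuous_on linear_conv_bounded_linear[THEN iffD1])
  ultimately have "\<exists>v \<in> S \<inter> sphere 0 1. \<forall>z \<in> S \<inter> sphere 0 1. norm (g v) \<le> norm (g z)"
    by (intro continuous_attains_inf)
  then obtain v where v: "v \<in> S" "norm v = 1"
    and min: "\<And>z. z \<in> S \<Longrightarrow> norm z = 1 \<Longrightarrow> norm (g v) \<le> norm (g z)"
    by auto
  have "norm (g v) * norm z \<le> norm (g z)" if "z \<in> S" for z
  proof (cases "z = 0")
    case False
    then have "norm (g v) \<le> norm (g z) / norm z"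
      using min[of "(1 / norm z) *\<^sub>R z"] norm_linear_normalized[OF \<open>linear g\<close>] that \<open>subspace S\<close>
      by (simp add: subspace_scale)
    then show ?thesis
      using False by (simp add: le_divide_eq)
  qed simp
  with v that show ?thesis
    by blast
qed

lemma norm_matrix_vector_squared_le:
  fixes K :: "real^'n^'m"
  assumes eigenvalues_le: "\<forall>l \<in> eigenvalues (transpose K ** K). l \<le> lam"
  shows "norm (K *v x) ^ 2 \<le> lam * norm x ^ 2"
proof -
  obtain v where v: "norm v = 1" and max: "\<And>z. norm (K *v z) \<le> norm (K *v v) * norm z"
    using linear_attains_max_stretch[OF matrix_vector_mul_linear] by blast
  define m where "m = norm (K *v v) ^ 2"
  have bound: "norm (K *v z) ^ 2 \<le> m * norm z ^ 2" for z
    using power_mono[OF max[of z] norm_ge_zero, of 2] unfolding m_def by (simp add: power_mult_distrib)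
  have "- ((transpose K ** K) *v v) = (- m) *\<^sub>R v"
  proof (rule rayleigh_minimizer_is_eigenvector[OF _ _ subspace_UNIV])
    show "linear (\<lambda>x. - ((transpose K ** K) *v x))"
      by (intro linear_compose_neg) simp
    show "- ((transpose K ** K) *v z) \<bullet> w = z \<bullet> - ((transpose K ** K) *v w)" for z w
      unfolding matrix_vector_mul_assoc[symmetric] inner_minus_left inner_minus_right
      by (metis inner_transpose_matrix_vector inner_commute)
    show "- m * norm z ^ 2 \<le> - ((transpose K ** K) *v z) \<bullet> z" for z
      using bound[of z] by (simp add: matrix_vector_mul_assoc[symmetric] dot_lmul_matrix power2_norm_eq_inner)
    show "- ((transpose K ** K) *v v) \<bullet> v = - m * norm v ^ 2"
      using v by (simp add: matrix_vector_mul_assoc[symmetric] dot_lmul_matrix m_def power2_norm_eq_inner)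
  qed auto
  then have "m \<in> eigenvalues (transpose K ** K)"
    unfolding eigenvalues_def using v by (auto intro!: exI[of _ v])
  then have "m * norm x ^ 2 \<le> lam * norm x ^ 2"
    using eigenvalues_le by (intro mult_right_mono) auto
  then show ?thesis
    using bound[of x] by linarith
qed

lemma norm_transpose_matrix_vector_squared_le:
  fixes K :: "real^'n^'m"
  assumes K_bound: "\<And>x. norm (K *v x) ^ 2 \<le> lam * norm x ^ 2" and "0 \<le> lam"
  shows "norm (transpose K *v y) ^ 2 \<le> lam * norm y ^ 2"
proof (cases "transpose K *v y = 0")
  case True
  then show ?thesis
    using \<open>0 \<le> lam\<close> by simp
next
  case False
  define a where "a = norm (transpose K *v y)"
  define B where "B = norm (K *v (transpose K *v y))"
  have "a > 0"
    unfolding a_def using False by simp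
  have "a ^ 2 = (K *v (transpose K *v y)) \<bullet> y"
    unfolding a_def power2_norm_eq_inner by (metis inner_transpose_matrix_vector inner_commute)
  also have "\<dots> \<le> B * norm y"
    unfolding B_def by (rule norm_cauchy_schwarz)
  finally have "a ^ 2 * a ^ 2 \<le> (B * norm y) ^ 2"
    using \<open>a > 0\<close> by (metis power2_eq_square power_mono zero_le_power2)
  also have "\<dots> = B ^ 2 * norm y ^ 2"
    by (simp add: power_mult_distrib)
  also have "\<dots> \<le> lam * a ^ 2 * norm y ^ 2"
    using K_bound[of "transpose K *v y"] unfolding B_def a_def by (intro mult_right_mono) auto
  finally have "a ^ 2 * a ^ 2 \<le> a ^ 2 * (lam * norm y ^ 2)"
    by (simp add: algebra_simps)
  moreover have "a ^ 2 > 0"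
    using \<open>a > 0\<close> by simp
  ultimately show ?thesis
    unfolding a_def using mult_le_cancel_left_pos by blast
qed

lemma exists_pos_eigenvalue_bounding_transpose_on_range:
  fixes K :: "real^'n^'m"
  assumes "K \<noteq> 0"
  shows "\<exists>m \<in> eigenvalues (transpose K ** K). 0 < m \<and>
    (\<forall>y \<in> range ((*v) K). m * norm y ^ 2 \<le> norm (transpose K *v y) ^ 2)"
proof -
  define S where "S = range ((*v) K)"
  have "subspace S"
    unfolding S_def by (intro real_vector.linear_subspace_image subspace_UNIV) simp
  obtain x1 where "K *v x1 \<noteq> 0"
    using \<open>K \<noteq> 0\<close> by (metis matrix_eq matrix_vector_mult_0)
  then obtain v where "v \<in> S" and v: "norm v = 1"
    and min: "\<And>z. z \<in> S \<Longrightarrow> norm (transpose K *v v) * norm z \<le> norm (transpose K *v z)"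
    using linear_attains_min_stretch_on_subspace[OF matrix_vector_mul_linear \<open>subspace S\<close>, of "K *v x1"]
    unfolding S_def by blast
  define m where "m = norm (transpose K *v v) ^ 2"
  have bound: "m * norm z ^ 2 \<le> norm (transpose K *v z) ^ 2" if "z \<in> S" for z
    using power_mono[OF min[OF that], of 2] unfolding m_def by (simp add: power_mult_distrib)
  have Av: "K *v (transpose K *v v) = m *\<^sub>R v"
  proof (rule rayleigh_minimizer_is_eigenvector[OF _ _ \<open>subspace S\<close> \<open>v \<in> S\<close>])
    show "linear (\<lambda>y. K *v (transpose K *v y))"
      using linear_compose[of "(*v) (transpose K)" "(*v) K"] by (simp add: o_def)
    show "(K *v (transpose K *v z)) \<bullet> w = z \<bullet> (K *v (transpose K *v w))" for z w
      by (metis inner_transpose_matrix_vector inner_commute)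
    have quadratic_form: "(K *v (transpose K *v z)) \<bullet> z = norm (transpose K *v z) ^ 2" for z
      by (metis inner_transpose_matrix_vector inner_commute power2_norm_eq_inner)
    show "m * norm z ^ 2 \<le> (K *v (transpose K *v z)) \<bullet> z" if "z \<in> S" for z
      unfolding quadratic_form using bound[OF that] .
    show "(K *v (transpose K *v v)) \<bullet> v = m * norm v ^ 2"
      unfolding quadratic_form m_def using v by simp
  qed (auto simp: S_def)
  have "transpose K *v v \<noteq> 0"
  proof
    assume "transpose K *v v = 0"
    moreover obtain x0 where "v = K *v x0"
      using \<open>v \<in> S\<close> unfolding S_def by auto
    ultimately have "v \<bullet> v = 0"
      using inner_transpose_matrix_vector[of K v x0] by (simp add: inner_commute)
    then show False
      using v by simp
  qed
  moreover have "(transpose K ** K) *v (transpose K *v v) = transpose K *v (K *v (transpose K *v v))"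
    by (rule matrix_vector_mul_assoc[symmetric])
  moreover have "\<dots> = m *\<^sub>R (transpose K *v v)"
    unfolding Av by (simp only: matrix_vector_mult_scaleR)
  ultimately have "m \<in> eigenvalues (transpose K ** K)"
    unfolding eigenvalues_def by auto
  moreover have "0 < m"
    unfolding m_def using \<open>transpose K *v v \<noteq> 0\<close> by simp
  ultimately show ?thesis
    using bound unfolding S_def by blast
qed

lemma transpose_bounds_of_eigenvalue_bounds:
  fixes K :: "real^'n^'m"
  assumes "K \<noteq> 0"
    and upper: "\<forall>l \<in> eigenvalues (transpose K ** K). l \<le> lam1"
    and lower: "\<forall>l \<in> eigenvalues (transpose K ** K). 0 < l \<longrightarrow> lam2 \<le> l"
  shows "0 < lam1" "lam2 \<le> lam1"
    and "\<And>y. norm (transpose K *v y) ^ 2 \<le> lam1 * norm y ^ 2"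
    and "\<And>y. y \<in> range ((*v) K) \<Longrightarrow> lam2 * norm y ^ 2 \<le> norm (transpose K *v y) ^ 2"
proof -
  obtain m where m: "m \<in> eigenvalues (transpose K ** K)" "0 < m"
    and m_bound: "\<And>y. y \<in> range ((*v) K) \<Longrightarrow> m * norm y ^ 2 \<le> norm (transpose K *v y) ^ 2"
    using exists_pos_eigenvalue_bounding_transpose_on_range[OF \<open>K \<noteq> 0\<close>] by blast
  have "lam2 \<le> m" "m \<le> lam1"
    using m upper lower by auto
  then show "0 < lam1" "lam2 \<le> lam1"
    using \<open>0 < m\<close> by linarith+
  then show "norm (transpose K *v y) ^ 2 \<le> lam1 * norm y ^ 2" for y
    by (intro norm_transpose_matrix_vector_squared_le norm_matrix_vector_squared_le upper) simp
  show "lam2 * norm y ^ 2 \<le> norm (transpose K *v y) ^ 2" if "y \<in> range ((*v) K)" for y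
    using mult_right_mono[OF \<open>lam2 \<le> m\<close> zero_le_power2[of "norm y"]] m_bound[OF that] by linarith
qed

lemma contraction_of_descent:
  fixes X Y D N Psi M rho eta alpha tau :: real
  assumes descent: "(1 / eta + alpha) * X + Y + (2 - tau) / tau * D \<le> Psi - N"
    and dual: "Y \<le> M * N"
    and "0 \<le> X" "0 \<le> D" "0 \<le> N" "0 < eta" "0 < tau"
    and rho: "1 \<le> rho" "rho - 1 \<le> eta * alpha" "2 * (rho - 1) * (1 - tau) \<le> tau" "(rho - 1) * M \<le> 1"
  shows "rho * (1 / eta * X + Y + 2 * (1 - tau) / tau * D) \<le> Psi"
proof -
  have "rho * (1 / eta) \<le> 1 / eta + alpha"
    using rho \<open>0 < eta\<close> by (simp add: field_simps)
  from mult_right_mono[OF this \<open>0 \<le> X\<close>] have "rho * (1 / eta * X) \<le> (1 / eta + alpha) * X"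
    by (simp only: mult.assoc)
  moreover have "rho * (2 * (1 - tau)) \<le> 2 - tau"
    using rho(3) by (simp add: algebra_simps)
  then have "rho * (2 * (1 - tau) / tau) \<le> (2 - tau) / tau"
    using divide_right_mono[of _ _ tau] \<open>0 < tau\<close> by fastforce
  from mult_right_mono[OF this \<open>0 \<le> D\<close>] have "rho * (2 * (1 - tau) / tau * D) \<le> (2 - tau) / tau * D"
    by (simp only: mult.assoc)
  moreover have "(rho - 1) * Y \<le> N"
  proof -
    have "(rho - 1) * Y \<le> (rho - 1) * M * N"
      using dual rho by (simp add: mult.assoc mult_left_mono)
    also have "\<dots> \<le> N"
      using mult_right_mono[OF \<open>(rho - 1) * M \<le> 1\<close> \<open>0 \<le> N\<close>] by simp
    finally show ?thesis .
  qed
  ultimately show ?thesis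
    using descent by (simp add: algebra_simps)
qed

lemma algB_step_size_bounds:
  fixes kappa chi :: real
  assumes kappa: "1 \<le> kappa" and chi: "1 \<le> chi"
  defines "tau \<equiv> min 1 (1/2 * sqrt (chi / kappa))"
  shows "0 < tau" "tau \<le> 1" "1 / 2 \<le> tau * kappa" "tau * kappa \<le> sqrt (kappa * chi) / 2"
    and "tau = min 1 (chi / (2 * sqrt (kappa * chi)))"
proof -
  define q where "q = sqrt (chi / kappa)"
  define p where "p = sqrt (kappa * chi)"
  have "0 < q"
    unfolding q_def using kappa chi by simp
  have "1 \<le> p"
    unfolding p_def using mult_mono[OF kappa chi] kappa chi by simp
  have pq: "p * q = chi"
    unfolding p_def q_def using kappa chi by (simp flip: real_sqrt_mult)
  have p_eq: "p = kappa * q"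
  proof -
    have "kappa * chi = kappa ^ 2 * (chi / kappa)"
      using kappa chi by (simp add: power2_eq_square)
    then have "p = sqrt (kappa ^ 2) * sqrt (chi / kappa)"
      unfolding p_def by (simp only: real_sqrt_mult)
    then show ?thesis
      unfolding q_def using kappa chi by simp
  qed
  have tau_eq: "tau = min 1 (q / 2)"
    unfolding tau_def q_def by simp
  show "0 < tau" "tau \<le> 1"
    unfolding tau_eq using \<open>0 < q\<close> by auto
  show "tau * kappa \<le> p / 2" unfolding p_def[symmetric]
    using mult_right_mono[of tau "q / 2" kappa] kappa chi unfolding tau_eq p_eq by simp
  show "1 / 2 \<le> tau * kappa"
  proof (cases "q / 2 \<le> 1")
    case True
    then have "tau * kappa = p / 2"
      unfolding tau_eq p_eq by simp
    then show ?thesis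
      using \<open>1 \<le> p\<close> by simp
  qed (use kappa in \<open>simp add: tau_eq\<close>)
  show "tau = min 1 (chi / (2 * p))" unfolding p_def[symmetric]
    unfolding tau_eq pq[symmetric] using \<open>1 \<le> p\<close> by simp
qed

lemma algB_parameter_conditions:
  fixes kappa chi :: real
  assumes kappa: "1 \<le> kappa" and chi: "1 \<le> chi"
  defines "tau \<equiv> min 1 (1/2 * sqrt (chi / kappa))"
    and "r \<equiv> 1/4 * min (1 / sqrt (kappa * chi)) (1 / chi)"
  shows "0 \<le> r" "r \<le> 1 / (4 * tau * kappa)" "2 * r * (1 - tau) \<le> tau"
    "r * chi * (2 + 1 / (4 * tau * kappa) + 1 / (2 * tau)) \<le> 1"
proof -
  define p where "p = sqrt (kappa * chi)"
  note step_size = algB_step_size_bounds[OF kappa chi, folded tau_def p_def]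
  have "1 \<le> p"
    unfolding p_def using mult_mono[OF kappa chi] kappa chi by simp
  have r_le: "r \<le> 1 / (4 * p)" "r \<le> 1 / (4 * chi)"
    unfolding r_def p_def by auto
  show "0 \<le> r"
    unfolding r_def using kappa chi by simp
  have "1 / (4 * p) \<le> 1 / (4 * tau * kappa)"
    using step_size \<open>1 \<le> p\<close> by (simp add: field_simps)
  then show "r \<le> 1 / (4 * tau * kappa)"
    using r_le by linarith
  have "2 * r \<le> tau"
  proof -
    have "2 * r \<le> chi / (2 * p)"
      using r_le(1) \<open>1 \<le> p\<close> chi by (simp add: field_simps)
    moreover have "1 / (4 * chi) \<le> 1 / 4"
      using chi by (simp add: field_simps)
    then have "2 * r \<le> 1"
      using r_le(2) by linarith
    ultimately show ?thesis
      unfolding step_size(5) by simp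
  qed
  moreover have "2 * r * (1 - tau) \<le> 2 * r"
    using mult_left_le[of "1 - tau" "2 * r"] \<open>0 \<le> r\<close> step_size by simp
  ultimately show "2 * r * (1 - tau) \<le> tau"
    by linarith
  have r_chi: "r * chi \<le> 1 / 4" "r * chi \<le> tau / 2"
  proof -
    show "r * chi \<le> 1 / 4"
      using r_le chi by (simp add: field_simps)
    have "r * chi \<le> chi / (4 * p)"
      using mult_right_mono[OF r_le(1), of chi] chi by simp
    then show "r * chi \<le> tau / 2"
      unfolding step_size(5) using \<open>r * chi \<le> 1 / 4\<close> by (auto simp: min_def)
  qed
  have "r * chi * (1 / (4 * tau * kappa)) \<le> 1 / 4 * (1 / 2)"
    using r_chi step_size \<open>0 \<le> r\<close> chi by (intro mult_mono) (auto simp: field_simps)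
  moreover have "r * chi * (1 / (2 * tau)) \<le> 1 / 4"
    using r_chi step_size by (simp add: field_simps)
  ultimately show "r * chi * (2 + 1 / (4 * tau * kappa) + 1 / (2 * tau)) \<le> 1"
    using r_chi by (simp only: distrib_left)
qed

(* The updates in the error variables z - xs and w - ys, in the shape used by the estimates above. *)
lemma algB_step_error_equations:
  fixes K :: "real^'d^'p"
  assumes opt: "gradF xs + transpose K *v ys = 0" and feas: "K *v xs = b"
    and "0 < eta" "0 \<le> alpha"
    and xh: "xh = inverse (1 + eta * alpha) *\<^sub>R (x - eta *\<^sub>R (gradF xg - alpha *\<^sub>R xg + transpose K *v y))"
    and y': "y' = y + theta *\<^sub>R (K *v xh - b)"
    and x': "x' = inverse (1 + eta * alpha) *\<^sub>R (x - eta *\<^sub>R (gradF xg - alpha *\<^sub>R xg + transpose K *v y'))"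
  shows "(1 / eta) *\<^sub>R ((x' - xs) - (x - xs)) + alpha *\<^sub>R ((x' - xs) - (xg - xs)) + (gradF xg - gradF xs)
      + transpose K *v (y' - ys) = 0"
    and "(xh - xs) - (x' - xs) = (eta / (1 + eta * alpha)) *\<^sub>R (transpose K *v ((y' - ys) - (y - ys)))"
    and "y' - ys = (y - ys) + theta *\<^sub>R (K *v (xh - xs))"
proof -
  have c_pos: "0 < 1 + eta * alpha"
    using mult_nonneg_nonneg[of eta alpha] \<open>0 < eta\<close> \<open>0 \<le> alpha\<close> by linarith
  have update: "(1 / eta) *\<^sub>R (z - x) + alpha *\<^sub>R (z - xg) + gradF xg + transpose K *v w = 0"
    if "z = inverse (1 + eta * alpha) *\<^sub>R (x - eta *\<^sub>R (gradF xg - alpha *\<^sub>R xg + transpose K *v w))" for z w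
  proof -
    have "(1 + eta * alpha) *\<^sub>R z = x - eta *\<^sub>R (gradF xg - alpha *\<^sub>R xg + transpose K *v w)"
      using that c_pos by simp
    then have "eta *\<^sub>R ((1 / eta) *\<^sub>R (z - x) + alpha *\<^sub>R (z - xg) + gradF xg + transpose K *v w) = 0"
      using \<open>0 < eta\<close> by (simp add: algebra_simps)
    then show ?thesis
      using \<open>0 < eta\<close> by simp
  qed
  have "gradF xs = - (transpose K *v ys)"
    using eq_neg_iff_add_eq_0 opt by blast
  then have "transpose K *v (y' - ys) = transpose K *v y' + gradF xs"
    by (simp only: matrix_vector_mult_diff_distrib) simp
  then have "(1 / eta) *\<^sub>R ((x' - xs) - (x - xs)) + alpha *\<^sub>R ((x' - xs) - (xg - xs)) + (gradF xg - gradF xs)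
      + transpose K *v (y' - ys) = (1 / eta) *\<^sub>R (x' - x) + alpha *\<^sub>R (x' - xg) + gradF xg + transpose K *v y'"
    by (simp only:) (simp add: algebra_simps)
  also have "\<dots> = 0"
    by (rule update[OF x'])
  finally show "(1 / eta) *\<^sub>R ((x' - xs) - (x - xs)) + alpha *\<^sub>R ((x' - xs) - (xg - xs)) + (gradF xg - gradF xs)
      + transpose K *v (y' - ys) = 0" .
  have "(1 / eta + alpha) *\<^sub>R (x' - xh) + transpose K *v (y' - y)
      = ((1 / eta) *\<^sub>R (x' - x) + alpha *\<^sub>R (x' - xg) + gradF xg + transpose K *v y')
        - ((1 / eta) *\<^sub>R (xh - x) + alpha *\<^sub>R (xh - xg) + gradF xg + transpose K *v y)"
    by (simp add: algebra_simps matrix_vector_mult_diff_distrib)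
  also have "\<dots> = 0"
    using update[OF x'] update[OF xh] by simp
  finally have "transpose K *v (y' - y) = - ((1 / eta + alpha) *\<^sub>R (x' - xh))"
    by (simp only: add_eq_0_iff)
  also have "\<dots> = ((1 + eta * alpha) / eta) *\<^sub>R (xh - x')"
    using \<open>0 < eta\<close> by (simp add: field_simps)
  finally have "(eta / (1 + eta * alpha)) *\<^sub>R (transpose K *v (y' - y)) = xh - x'"
    using \<open>0 < eta\<close> c_pos by simp
  then show "(xh - xs) - (x' - xs) = (eta / (1 + eta * alpha)) *\<^sub>R (transpose K *v ((y' - ys) - (y - ys)))"
    by simp
  show "y' - ys = (y - ys) + theta *\<^sub>R (K *v (xh - xs))"
    unfolding y' feas[symmetric] by (simp add: matrix_vector_mult_diff_distrib algebra_simps)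
qed

lemma algB_Suc:
  "algB gradF K b eta theta alpha tau x0 (Suc k)
    = algB_step gradF K b eta theta alpha tau (algB gradF K b eta theta alpha tau x0 k)"
  by (simp add: algB_def)

lemma algB_step_dual_error_in_range:
  fixes K :: "real^'d^'p"
  assumes "K *v xs = b" and "y - ys \<in> range ((*v) K)"
  shows "fst (snd (algB_step gradF K b eta theta alpha tau (x, y, xf))) - ys \<in> range ((*v) K)"
proof -
  have "y + theta *\<^sub>R (K *v v - b) - ys \<in> range ((*v) K)" for v
  proof -
    obtain z where "y - ys = K *v z"
      using \<open>y - ys \<in> range ((*v) K)\<close> by auto
    then have "y + theta *\<^sub>R (K *v v - b) - ys = K *v (z + theta *\<^sub>R (v - xs))"
      unfolding \<open>K *v xs = b\<close>[symmetric]
      by (simp add: matrix_vector_right_distrib matrix_vector_mult_diff_distrib matrix_vector_mult_scaleR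
          algebra_simps)
    then show ?thesis
      by (metis rangeI)
  qed
  then show ?thesis
    unfolding algB_step_def Let_def by simp
qed

locale algB_analysis = smooth_strongly_convex F gradF \<mu> L
  for F :: "real^'d \<Rightarrow> real" and gradF \<mu> L +
  fixes K :: "real^'d^'p" and b :: "real^'p" and xs :: "real^'d" and ys :: "real^'p"
    and lam1 lam2 tau eta theta alpha rho :: real
  assumes saddle_point: "gradF xs + transpose K *v ys = 0" and ys_range: "ys \<in> range ((*v) K)"
    and feasible: "K *v xs = b"
    and transpose_upper: "\<And>y. norm (transpose K *v y) ^ 2 \<le> lam1 * norm y ^ 2"
    and transpose_lower: "\<And>y. y \<in> range ((*v) K) \<Longrightarrow> lam2 * norm y ^ 2 \<le> norm (transpose K *v y) ^ 2"
    and lam1_pos: "0 < lam1" and lam2_pos: "0 < lam2" and tau_pos: "0 < tau" and tau_le_1: "tau \<le> 1"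
    and eta_eq: "eta = 1 / (4 * tau * L)" and theta_eq: "theta = 1 / (eta * lam1)" and alpha_eq: "alpha = \<mu>"
    and rho_conditions: "1 \<le> rho" "rho - 1 \<le> eta * alpha" "2 * (rho - 1) * (1 - tau) \<le> tau"
      "(rho - 1) * (lam1 / lam2 * (2 + eta * alpha + 1 / (2 * tau))) \<le> 1"
begin

definition dual_energy :: "real^'p \<Rightarrow> real" where
  "dual_energy w = 1 / theta * norm w ^ 2 - eta / (1 + eta * alpha) * norm (transpose K *v w) ^ 2"

definition lyapunov :: "(real^'d) \<times> (real^'p) \<times> (real^'d) \<Rightarrow> real" where
  "lyapunov s = (case s of (x, y, xf) \<Rightarrow>
     1 / eta * norm (x - xs) ^ 2 + dual_energy (y - ys) + 2 * (1 - tau) / tau * bregman F gradF xf xs)"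

abbreviation "step \<equiv> algB_step gradF K b eta theta alpha tau"

lemma eta_pos: "0 < eta" and alpha_pos: "0 < alpha" and theta_pos: "0 < theta"
  using L_pos mu_pos tau_pos lam1_pos unfolding eta_eq alpha_eq theta_eq by simp_all

lemma one_le_one_plus_eta_alpha: "1 \<le> 1 + eta * alpha"
  using eta_pos alpha_pos by simp

lemma step_descent:
  assumes xg: "xg = tau *\<^sub>R x + (1 - tau) *\<^sub>R xf"
    and xh: "xh = inverse (1 + eta * alpha) *\<^sub>R (x - eta *\<^sub>R (gradF xg - alpha *\<^sub>R xg + transpose K *v y))"
    and y': "y' = y + theta *\<^sub>R (K *v xh - b)"
    and x': "x' = inverse (1 + eta * alpha) *\<^sub>R (x - eta *\<^sub>R (gradF xg - alpha *\<^sub>R xg + transpose K *v y'))"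
    and xf': "xf' = xg + (2 * tau / (2 - tau)) *\<^sub>R (x' - x)"
  shows "(1 / eta + alpha) * norm (x' - xs) ^ 2 + dual_energy (y' - ys) + (2 - tau) / tau * bregman F gradF xf' xs
    \<le> lyapunov (x, y, xf) - (1 / (2 * eta) * norm (x' - x) ^ 2 + alpha * norm (x' - xg) ^ 2
      + norm (gradF xg - gradF xs) ^ 2 / (2 * L))"
proof -
  note error = algB_step_error_equations[OF saddle_point feasible eta_pos less_imp_le[OF alpha_pos] xh y' x']
  have "0 \<le> eta / (1 + eta * alpha)"
    using eta_pos one_le_one_plus_eta_alpha by simp
  moreover have "eta / (1 + eta * alpha) \<le> eta"
    using mult_left_mono[OF one_le_one_plus_eta_alpha, of eta] eta_pos by (simp add: divide_le_eq)
  from mult_right_mono[OF this, of lam1] have "eta / (1 + eta * alpha) * lam1 \<le> 1 / theta"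
    using lam1_pos unfolding theta_eq by simp
  ultimately have "dual_energy (y' - ys) \<le> dual_energy (y - ys) + 2 * ((transpose K *v (y' - ys)) \<bullet> (x' - xs))"
    unfolding dual_energy_def
    by (rule dual_distance_estimate[OF inner_transpose_matrix_vector matrix_vector_mul_linear transpose_upper
          theta_pos _ _ error(3) error(2)])
  moreover have "1 / eta * norm (x' - xs) ^ 2 = 1 / eta * norm (x - xs) ^ 2 - 2 * (1 / (2 * eta) * norm (x' - x) ^ 2)
      - alpha * norm (x' - xs) ^ 2 - alpha * norm (x' - xg) ^ 2 + alpha * norm (xg - xs) ^ 2
      - 2 * ((gradF xg - gradF xs) \<bullet> (x' - xs)) - 2 * ((transpose K *v (y' - ys)) \<bullet> (x' - xs))"
    using primal_distance_identity[OF error(1)] by simp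
  moreover note gradient_coupling_bound[OF tau_pos tau_le_1 eta_eq xg xf', where xs = xs, folded alpha_eq bregman_def]
  ultimately show ?thesis
    unfolding lyapunov_def distrib_right by simp
qed

lemma dual_energy_le_slack:
  assumes "y' - ys \<in> range ((*v) K)"
    and residual: "(1 / eta) *\<^sub>R (x' - x) + alpha *\<^sub>R (x' - xg) + (gradF xg - gradF xs) + transpose K *v (y' - ys) = 0"
  shows "dual_energy (y' - ys) \<le> lam1 / lam2 * (2 + eta * alpha + 1 / (2 * tau))
    * (1 / (2 * eta) * norm (x' - x) ^ 2 + alpha * norm (x' - xg) ^ 2 + norm (gradF xg - gradF xs) ^ 2 / (2 * L))"
    (is "_ \<le> _ * ?N")
proof -
  have "dual_energy (y' - ys) \<le> eta * (lam1 / lam2) * (lam2 * norm (y' - ys) ^ 2)"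
    unfolding dual_energy_def using eta_pos alpha_pos lam2_pos by (simp add: theta_eq)
  also have "\<dots> \<le> eta * (lam1 / lam2) * norm (transpose K *v (y' - ys)) ^ 2"
    using transpose_lower[OF assms(1)] eta_pos lam1_pos lam2_pos by (intro mult_left_mono) auto
  also have "\<dots> \<le> eta * (lam1 / lam2) * ((2 / eta + alpha + 2 * L) * ?N)"
  proof -
    have "(1 / eta) *\<^sub>R ((x' - xs) - (x - xs)) + alpha *\<^sub>R ((x' - xs) - (xg - xs)) + (gradF xg - gradF xs)
        + transpose K *v (y' - ys) = 0"
      using residual by simp
    from norm_dual_residual_le[OF eta_pos alpha_pos L_pos this] show ?thesis
      using eta_pos lam1_pos lam2_pos by (intro mult_left_mono) auto
  qed
  also have "\<dots> = lam1 / lam2 * (2 + eta * alpha + 1 / (2 * tau)) * ?N"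
    using eta_pos tau_pos L_pos unfolding eta_eq by (simp add: field_simps)
  finally show ?thesis .
qed

lemma step_contracts:
  assumes "y - ys \<in> range ((*v) K)"
  shows "rho * lyapunov (step (x, y, xf)) \<le> lyapunov (x, y, xf)"
proof -
  define xg where "xg = tau *\<^sub>R x + (1 - tau) *\<^sub>R xf"
  define xh where "xh = inverse (1 + eta * alpha) *\<^sub>R (x - eta *\<^sub>R (gradF xg - alpha *\<^sub>R xg + transpose K *v y))"
  define y' where "y' = y + theta *\<^sub>R (K *v xh - b)"
  define x' where "x' = inverse (1 + eta * alpha) *\<^sub>R (x - eta *\<^sub>R (gradF xg - alpha *\<^sub>R xg + transpose K *v y'))"
  define xf' where "xf' = xg + (2 * tau / (2 - tau)) *\<^sub>R (x' - x)"
  have step_eq: "step (x, y, xf) = (x', y', xf')"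
    unfolding algB_step_def Let_def xg_def xh_def y'_def x'_def xf'_def by simp
  have "y' - ys \<in> range ((*v) K)"
    using algB_step_dual_error_in_range[OF feasible assms, of gradF eta theta alpha tau x xf]
    unfolding step_eq by simp
  moreover have "(1 / eta) *\<^sub>R (x' - x) + alpha *\<^sub>R (x' - xg) + (gradF xg - gradF xs) + transpose K *v (y' - ys) = 0"
    using algB_step_error_equations(1)[OF saddle_point feasible eta_pos less_imp_le[OF alpha_pos] xh_def y'_def x'_def]
    by simp
  ultimately have dual: "dual_energy (y' - ys) \<le> lam1 / lam2 * (2 + eta * alpha + 1 / (2 * tau))
    * (1 / (2 * eta) * norm (x' - x) ^ 2 + alpha * norm (x' - xg) ^ 2 + norm (gradF xg - gradF xs) ^ 2 / (2 * L))"
    by (rule dual_energy_le_slack)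
  have "0 \<le> bregman F gradF xf' xs"
    using convexity_lower_bound[of xs xf'] unfolding bregman_def by simp
  moreover have "0 \<le> 1 / (2 * eta) * norm (x' - x) ^ 2 + alpha * norm (x' - xg) ^ 2
      + norm (gradF xg - gradF xs) ^ 2 / (2 * L)"
    using eta_pos alpha_pos L_pos by simp
  ultimately have "rho * (1 / eta * norm (x' - xs) ^ 2 + dual_energy (y' - ys) + 2 * (1 - tau) / tau * bregman F gradF xf' xs)
      \<le> lyapunov (x, y, xf)"
    using contraction_of_descent[OF step_descent[OF xg_def xh_def y'_def x'_def xf'_def] dual]
      eta_pos tau_pos rho_conditions by simp
  then show ?thesis
    unfolding step_eq lyapunov_def by simp
qed

lemma lyapunov_lower_bound:
  "1 / eta * norm (x - xs) ^ 2 + eta * alpha / (theta * (1 + eta * alpha)) * norm (y - ys) ^ 2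
     + 2 * (1 - tau) / tau * bregman F gradF xf xs
   \<le> lyapunov (x, y, xf)"
proof -
  define c where "c = 1 + eta * alpha"
  have "0 < c"
    unfolding c_def using one_le_one_plus_eta_alpha by simp
  have "eta / c * norm (transpose K *v (y - ys)) ^ 2 \<le> eta / c * (lam1 * norm (y - ys) ^ 2)"
    using transpose_upper eta_pos \<open>0 < c\<close> by (intro mult_left_mono) auto
  also have "\<dots> = 1 / theta * norm (y - ys) ^ 2 - eta * alpha / (theta * c) * norm (y - ys) ^ 2"
    unfolding theta_eq c_def using eta_pos lam1_pos \<open>0 < c\<close> unfolding c_def by (simp add: field_simps)
  finally show ?thesis
    unfolding lyapunov_def dual_energy_def c_def[symmetric] by simp
qed

lemma lyapunov_decay:
  "fst (snd (algB gradF K b eta theta alpha tau x0 k)) - ys \<in> range ((*v) K)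
   \<and> lyapunov (algB gradF K b eta theta alpha tau x0 k) \<le> inverse rho ^ k * lyapunov (x0, 0, x0)"
proof (induction k)
  case 0
  obtain z where "ys = K *v z"
    using ys_range by auto
  then have "0 - ys = K *v (0 - z)"
    by (simp only: matrix_vector_mult_diff_distrib) simp
  then show ?case
    by (simp add: algB_def del: diff_0)
next
  case (Suc k)
  obtain x y xf where k: "algB gradF K b eta theta alpha tau x0 k = (x, y, xf)"
    by (cases "algB gradF K b eta theta alpha tau x0 k") auto
  have "y - ys \<in> range ((*v) K)"
    using Suc.IH unfolding k by simp
  have "0 < rho"
    using rho_conditions by simp
  have "lyapunov (step (x, y, xf)) \<le> inverse rho * lyapunov (x, y, xf)"
    using step_contracts[OF \<open>y - ys \<in> range ((*v) K)\<close>] \<open>0 < rho\<close> by (simp add: field_simps)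
  also have "\<dots> \<le> inverse rho * (inverse rho ^ k * lyapunov (x0, 0, x0))"
    using Suc.IH \<open>0 < rho\<close> unfolding k by (intro mult_left_mono) auto
  finally show ?case
    using algB_step_dual_error_in_range[OF feasible \<open>y - ys \<in> range ((*v) K)\<close>]
    unfolding algB_Suc k by simp
qed

theorem convergence:
  "case algB gradF K b eta theta alpha tau x0 k of (x, y, xf) \<Rightarrow>
     1 / eta * norm (x - xs) ^ 2 + eta * alpha / (theta * (1 + eta * alpha)) * norm (y - ys) ^ 2
       + 2 * (1 - tau) / tau * bregman F gradF xf xs
     \<le> inverse rho ^ k * (1 / eta * norm (x0 - xs) ^ 2 + 1 / theta * norm (0 - ys) ^ 2
       + 2 * (1 - tau) / tau * bregman F gradF x0 xs)"
proof -
  obtain x y xf where k: "algB gradF K b eta theta alpha tau x0 k = (x, y, xf)"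
    by (cases "algB gradF K b eta theta alpha tau x0 k") auto
  have "1 / eta * norm (x - xs) ^ 2 + eta * alpha / (theta * (1 + eta * alpha)) * norm (y - ys) ^ 2
      + 2 * (1 - tau) / tau * bregman F gradF xf xs \<le> lyapunov (x, y, xf)"
    by (rule lyapunov_lower_bound)
  also have "\<dots> \<le> inverse rho ^ k * lyapunov (x0, 0, x0)"
    using lyapunov_decay[of x0 k] unfolding k by simp
  also have "\<dots> \<le> inverse rho ^ k * (1 / eta * norm (x0 - xs) ^ 2 + 1 / theta * norm (0 - ys) ^ 2
      + 2 * (1 - tau) / tau * bregman F gradF x0 xs)"
    using eta_pos alpha_pos rho_conditions unfolding lyapunov_def dual_energy_def
    by (intro mult_left_mono) auto
  finally show ?thesis
    unfolding k by simp
qed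

end

theorem proposition1:
  fixes F :: "real^'d \<Rightarrow> real" and gradF :: "real^'d \<Rightarrow> real^'d"
    and K :: "real^'d^'p" and b :: "real^'p"
    and L \<mu> lam1 lam2 :: real
    and xs x0 :: "real^'d" and ys :: "real^'p"
  assumes grad: "\<And>x. (F has_derivative (\<lambda>h. gradF x \<bullet> h)) (at x)"
    and mu_pos: "0 < \<mu>" and mu_le_L: "\<mu> \<le> L"
    and smooth: "\<And>x y. norm (gradF x - gradF y) \<le> L * norm (x - y)"
    and strongly_convex: "convex_on UNIV (\<lambda>x. F x - \<mu> / 2 * norm x ^ 2)"
    and K_nz: "K \<noteq> 0"
    and b_range: "b \<in> range (\<lambda>x. K *v x)"
    and xs_feas: "K *v xs = b"
    and xs_min: "\<And>x. K *v x = b \<Longrightarrow> F xs \<le> F x"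
    and ys_range: "ys \<in> range (\<lambda>x. K *v x)"
    and ys_opt: "gradF xs + transpose K *v ys = 0"
    and lam1_bd: "\<forall>l \<in> eigenvalues (transpose K ** K). l \<le> lam1"
    and lam2_pos: "0 < lam2"
    and lam2_bd: "\<forall>l \<in> eigenvalues (transpose K ** K). 0 < l \<longrightarrow> lam2 \<le> l"
  shows "let kappa = L / \<mu>; chi = lam1 / lam2;
             tau = min 1 (1/2 * sqrt (chi / kappa));
             eta = 1 / (4 * tau * L);
             theta = 1 / (eta * lam1);
             alpha = \<mu>;
             C = 1/eta * norm (x0 - xs)^2 + 1/theta * norm (0 - ys)^2
                 + 2 * (1 - tau) / tau * bregman F gradF x0 xs
         in \<forall>k. (case algB gradF K b eta theta alpha tau x0 k of (x, y, xf) \<Rightarrow>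
                  1/eta * norm (x - xs)^2
                  + eta * alpha / (theta * (1 + eta * alpha)) * norm (y - ys)^2
                  + 2 * (1 - tau) / tau * bregman F gradF xf xs
                \<le> inverse (1 + 1/4 * min (1 / sqrt (kappa * chi)) (1 / chi)) ^ k * C)"
proof -
  note spectral = transpose_bounds_of_eigenvalue_bounds[OF K_nz lam1_bd lam2_bd]
  define kappa where "kappa = L / \<mu>"
  define chi where "chi = lam1 / lam2"
  define tau where "tau = min 1 (1/2 * sqrt (chi / kappa))"
  define eta where "eta = 1 / (4 * tau * L)"
  define theta where "theta = 1 / (eta * lam1)"
  define r where "r = 1/4 * min (1 / sqrt (kappa * chi)) (1 / chi)"
  have "1 \<le> kappa" "1 \<le> chi"
    unfolding kappa_def chi_def using mu_pos mu_le_L lam2_pos spectral(2) by simp_all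
  note step_size = algB_step_size_bounds[OF this, folded tau_def]
  note parameters = algB_parameter_conditions[OF \<open>1 \<le> kappa\<close> \<open>1 \<le> chi\<close>, folded tau_def r_def]
  have "eta * \<mu> = 1 / (4 * tau * kappa)"
    unfolding eta_def kappa_def using mu_pos by simp
  moreover have "r * (lam1 / lam2 * (2 + eta * \<mu> + 1 / (2 * tau))) \<le> 1"
    using parameters(4) unfolding \<open>eta * \<mu> = 1 / (4 * tau * kappa)\<close> chi_def by (simp add: mult.assoc)
  ultimately interpret algB_analysis F gradF \<mu> L K b xs ys lam1 lam2 tau eta theta \<mu> "1 + r"
    using grad mu_pos mu_le_L smooth strongly_convex ys_opt ys_range xs_feas spectral lam2_pos
      step_size(1,2) parameters(1-3)
    by unfold_locales (simp_all add: eta_def theta_def)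
  show ?thesis
    unfolding Let_def kappa_def[symmetric] chi_def[symmetric] tau_def[symmetric] eta_def[symmetric]
      theta_def[symmetric] r_def[symmetric]
    by (intro allI convergence)
qed

end
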